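(* Let $n, m, \ell \ge 1$ be integers, let $\Omega \subseteq \mathbb{R}^n$ be a nonempty open set, let $s \in (0,1)$ and $p \in [1, +\infty)$. If $sp < 1$ and if the function $f : \mathbb{R}^m \to \mathbb{R}^\ell$ is not injective, then there exists a sequence $(u_j)_{j \in \mathbb{N}}$ in $\dot{W}^{s,p}(\Omega, \mathbb{R}^m)$ such that for every $j \in \mathbb{N}$ the function $f \circ u_j$ is constant on $\Omega$ and such that $$ \lim_{j \to \infty} \iint_{\Omega \times \Omega} \frac{|u_j(y) - u_j(x)|^p}{|y - x|^{n + sp}} \, \mathrm{d}y \, \mathrm{d}x = +\infty. $$
   Context: For $\Omega \subseteq \mathbb{R}^n$, $0 < s < 1$ and $1 \le p < +\infty$, the homogeneous fractional Sobolev space $\dot{W}^{s,p}(\Omega, \mathbb{R}^m)$ is the set of (measurable) functions $v : \Omega \to \mathbb{R}^m$ such that $$\iint_{\Omega \times \Omega} \frac{|v(y) - v(x)|^p}{|y - x|^{n + sp}} \, \mathrm{d}y \, \mathrm{d}x < +\infty.$$ *)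

theory Defs
  imports "HOL-Analysis.Analysis"
begin

text \<open>
  A function on \<open>\<Omega>\<close> is represented by a total function; only its values on \<open>\<Omega>\<close> matter below.
  The double integral is a Lebesgue integral with values in \<open>[0, \<infinity>]\<close>.
  On the diagonal, a null set, the integrand is \<open>0 / 0 = 0\<close>.
\<close>

definition frac_energy :: "(real ^ 'n) set \<Rightarrow> real \<Rightarrow> real \<Rightarrow> (real ^ 'n \<Rightarrow> real ^ 'm) \<Rightarrow> ennreal" where
  "frac_energy \<Omega> s p v =
    (\<integral>\<^sup>+ (x, y). ennreal (norm (v y - v x) powr p / norm (y - x) powr (real CARD('n) + s * p))
      \<partial>(lebesgue_on \<Omega> \<Otimes>\<^sub>M lebesgue_on \<Omega>))"

definition hom_frac_sobolev :: "(real ^ 'n) set \<Rightarrow> real \<Rightarrow> real \<Rightarrow> (real ^ 'n \<Rightarrow> real ^ 'm) set" where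
  "hom_frac_sobolev \<Omega> s p = {v \<in> borel_measurable (lebesgue_on \<Omega>). frac_energy \<Omega> s p v < \<infinity>}"

end

theory Submission
  imports Defs
begin

text \<open>
  Choose \<open>a \<noteq> b\<close> with \<open>f a = f b\<close>. A function that takes only the values \<open>a\<close> and \<open>b\<close> is
  invisible after composition with \<open>f\<close>, but it still pays for every jump. If it equals \<open>a\<close> exactly
  on \<open>A\<close>, its energy is \<open>norm (b - a) powr p\<close> times the integral of \<open>1 / norm (y - x) powr (n + s * p)\<close>
  over the pairs \<open>(x, y)\<close> that \<open>A\<close> separates (lemma \<open>frac_energy_two_valued\<close>). It remains to find sets
  \<open>A\<close> for which this integral is finite but as large as desired.

  Finiteness is where \<open>s * p < 1\<close> enters. For a box, and hence for a finite union of boxes, a translation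
  by \<open>h\<close> changes the set by a set of measure at most \<open>C * min 1 (norm h)\<close>
  (lemma \<open>lipschitz_translates_cbox\<close>). Integrating first in \<open>x\<close> with \<open>h = y - x\<close> fixed leaves the
  integral of \<open>C * min 1 (norm h) / norm h powr (n + s * p)\<close>, which converges at the origin because
  \<open>s * p < 1\<close> and at infinity because \<open>s * p > 0\<close> (lemmas \<open>nn_integral_translation_kernel_finite\<close> and
  \<open>cross_energy_finite\<close>).

  For the divergence, fill a cube of side \<open>L\<close> inside \<open>\<Omega>\<close> with parallel stripes of width \<open>w\<close> that lie
  alternately inside and outside \<open>A\<close>. Each point of the cube then has, within distance comparable to
  \<open>w\<close>, a cube of volume \<open>w ^ n\<close> on the other side of \<open>A\<close>, so the integral is at least a constant times
  \<open>L ^ n * w ^ n * w powr (- (n + s * p))\<close>, that is, a constant times \<open>w powr (- (s * p))\<close>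
  (lemma \<open>striped_set_large_cross_energy\<close>). This tends to infinity as \<open>w\<close> tends to \<open>0\<close>.
\<close>

section \<open>An integrable kernel\<close>

lemma dyadic_above:
  fixes t :: real assumes "1 \<le> t"
  obtains k :: nat where "2 ^ k \<le> t" "t < 2 ^ Suc k"
proof -
  obtain N where N: "t < 2 ^ N" using real_arch_pow[of 2 t] by auto
  define m where "m = (LEAST m. t < 2 ^ m)"
  have 1: "t < 2 ^ m" unfolding m_def by (rule LeastI[of _ N]) (rule N)
  then have "m \<noteq> 0" using assms by (intro notI) simp
  then obtain k where k: "m = Suc k" by (cases m) auto
  have "\<not> t < 2 ^ k" using not_less_Least[of k "\<lambda>m. t < 2 ^ m"] k m_def by simp
  then show thesis using that[of k] 1 k by simp
qed

text \<open>
  On the shell where \<open>norm h\<close> lies between \<open>2 ^ k\<close> and \<open>2 ^ Suc k\<close>, replace the integrand by its bound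
  there and the shell by the enclosing ball; do the same for the shells that shrink to the origin.
  The resulting series are geometric, with ratios \<open>2 powr (n - \<alpha>)\<close> outside the unit ball
  and \<open>2 powr (\<alpha> - n - 1)\<close> inside it.
\<close>
lemma nn_integral_translation_kernel_finite:
  fixes \<alpha> :: real
  assumes "real DIM('a::euclidean_space) < \<alpha>" "\<alpha> < real DIM('a) + 1"
  shows "(\<integral>\<^sup>+ h. ennreal (min 1 (norm (h::'a)) / norm h powr \<alpha>) \<partial>lborel) < \<infinity>"
proof -
  define n where "n = DIM('a)"
  define \<omega> where "\<omega> = unit_ball_vol (real n)"
  have \<omega>: "0 \<le> \<omega>" by (simp add: \<omega>_def unit_ball_vol_nonneg)
  have \<alpha>: "0 < \<alpha>" using assms by (simp add: le_less_trans[of 0 "real DIM('a)"])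
  \<comment> \<open>\<open>f k\<close> and \<open>g k\<close> dominate the integrand on the \<open>k\<close>-th shell outside and inside the unit ball.\<close>
  define f where "f k h = ennreal ((2 ^ k) powr (- \<alpha>)) * indicator (cball 0 (2 ^ Suc k)) h" for k :: nat and h :: 'a
  define g where "g k h = ennreal ((1 / 2) ^ k * (2 ^ Suc k) powr \<alpha>) * indicator (cball 0 ((1 / 2) ^ k)) h" for k :: nat and h :: 'a
  have term_le: "x \<le> (\<Sum>k. F k)" if "x \<le> F k" for x :: ennreal and F and k :: nat
    using sum_le_suminf[of F "{k}"] that by (auto intro: order_trans)
  have pw: "ennreal (min 1 (norm h) / norm h powr \<alpha>) \<le> (\<Sum>k. f k h) + (\<Sum>k. g k h)" for h :: 'a
  proof (cases "1 \<le> norm h")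
    case True
    obtain k where k: "2 ^ k \<le> norm h" "norm h < 2 ^ Suc k" using dyadic_above[OF True] .
    have "min 1 (norm h) / norm h powr \<alpha> = norm h powr (- \<alpha>)"
      using True by (simp add: powr_minus divide_inverse)
    also have "\<dots> \<le> (2 ^ k) powr (- \<alpha>)"
      using k \<alpha> by (intro powr_mono2') auto
    finally have "ennreal (min 1 (norm h) / norm h powr \<alpha>) \<le> f k h"
      using k unfolding f_def by (simp add: ennreal_leI)
    then have "ennreal (min 1 (norm h) / norm h powr \<alpha>) \<le> (\<Sum>k. f k h)" by (rule term_le)
    then show ?thesis by (metis add_increasing2 zero_le)
  next
    case False
    show ?thesis
    proof (cases "h = 0")
      case True
      then show ?thesis by simp
    next
      case nz: False
      then have "1 \<le> 1 / norm h" using False by (simp add: field_simps)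
      then obtain k where k: "2 ^ k \<le> 1 / norm h" "1 / norm h < 2 ^ Suc k" by (rule dyadic_above)
      have k1: "norm h \<le> (1 / 2) ^ k" using k(1) nz by (simp add: field_simps power_divide)
      have k2: "1 / 2 ^ Suc k \<le> norm h" using k(2) nz by (simp add: field_simps)
      have "norm h powr (- \<alpha>) \<le> (1 / 2 ^ Suc k) powr (- \<alpha>)"
        using k2 \<alpha> by (intro powr_mono2') auto
      also have "\<dots> = (2 ^ Suc k) powr \<alpha>"
        by (simp add: powr_minus powr_divide)
      finally have "min 1 (norm h) * norm h powr (- \<alpha>) \<le> (1 / 2) ^ k * (2 ^ Suc k) powr \<alpha>"
        using k1 False by (intro mult_mono) auto
      then have "min 1 (norm h) / norm h powr \<alpha> \<le> (1 / 2) ^ k * (2 ^ Suc k) powr \<alpha>"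
        by (simp only: powr_minus divide_inverse)
      moreover have "h \<in> cball 0 ((1 / 2) ^ k)" using k1 by simp
      ultimately have "ennreal (min 1 (norm h) / norm h powr \<alpha>) \<le> g k h"
        unfolding g_def by (simp only: ennreal_leI indicator_simps mult_1_right)
      then have "ennreal (min 1 (norm h) / norm h powr \<alpha>) \<le> (\<Sum>k. g k h)" by (rule term_le)
      then show ?thesis by (metis add_increasing zero_le)
    qed
  qed
  have [measurable]: "f k \<in> borel_measurable lborel" "g k \<in> borel_measurable lborel" for k
    unfolding f_def g_def by (intro borel_measurable_times_ennreal borel_measurable_indicator; simp)+
  have If: "(\<integral>\<^sup>+ h. f k h \<partial>lborel) = ennreal (\<omega> * 2 ^ n * (2 powr (real n - \<alpha>)) ^ k)" for k
  proof -
    have e: "emeasure lborel (cball (0::'a) (2 ^ Suc k)) = ennreal (\<omega> * (2 ^ Suc k) ^ n)"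
      by (subst emeasure_cball) (simp_all add: \<omega>_def n_def)
    have "((2::real) ^ k) powr (- \<alpha>) = 2 powr (- \<alpha> * k)"
      by (simp add: powr_powr powr_realpow[symmetric] mult.commute)
    moreover have "((2::real) ^ Suc k) ^ n = 2 ^ n * 2 powr (n * k)"
      by (simp add: power_mult_distrib powr_realpow[symmetric] powr_powr powr_power mult.commute)
    moreover have "(2 powr (real n - \<alpha>)) ^ k = 2 powr (n * k) * 2 powr (- \<alpha> * k)"
      by (simp add: powr_power powr_add[symmetric] algebra_simps)
    ultimately have "(2 ^ k) powr (- \<alpha>) * (\<omega> * (2 ^ Suc k) ^ n) = \<omega> * 2 ^ n * (2 powr (real n - \<alpha>)) ^ k"
      by (simp only: mult_ac)
    then show ?thesis
      unfolding f_def using \<omega> by (simp add: nn_integral_cmult_indicator e ennreal_mult[symmetric] del: power_Suc)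
  qed
  have Ig: "(\<integral>\<^sup>+ h. g k h \<partial>lborel) = ennreal (\<omega> * 2 powr \<alpha> * (2 powr (\<alpha> - real n - 1)) ^ k)" for k
  proof -
    have e: "emeasure lborel (cball (0::'a) ((1 / 2) ^ k)) = ennreal (\<omega> * ((1 / 2) ^ k) ^ n)"
      by (subst emeasure_cball) (simp_all add: \<omega>_def n_def)
    have "((2::real) ^ Suc k) powr \<alpha> = 2 powr \<alpha> * 2 powr (\<alpha> * k)"
      unfolding powr_realpow[symmetric, OF zero_less_numeral] powr_powr
      by (simp add: powr_add[symmetric] algebra_simps)
    moreover have "((1 / 2 :: real) ^ k) ^ n = 2 powr (- real n * k)" "(1 / 2 :: real) ^ k = 2 powr (- real k)"
      by (simp_all add: power_one_over powr_minus powr_realpow[symmetric] powr_powr powr_power field_simps)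
    moreover have "(2 powr (\<alpha> - real n - 1)) ^ k = 2 powr (- real k) * (2 powr (\<alpha> * k) * 2 powr (- real n * k))"
      by (simp add: powr_power powr_add[symmetric] algebra_simps)
    ultimately have "(1 / 2) ^ k * (2 ^ Suc k) powr \<alpha> * (\<omega> * ((1 / 2) ^ k) ^ n) = \<omega> * 2 powr \<alpha> * (2 powr (\<alpha> - real n - 1)) ^ k"
      by (simp only: mult_ac)
    then show ?thesis
      unfolding g_def using \<omega> by (simp add: nn_integral_cmult_indicator e ennreal_mult[symmetric] del: power_Suc)
  qed
  have fin: "(\<Sum>k. ennreal (c * q ^ k)) < \<infinity>" if "0 \<le> c" "0 \<le> q" "q < 1" for c q :: real
    using that by (subst suminf_ennreal2) (auto intro!: summable_mult summable_geometric)
  have "(\<integral>\<^sup>+ h. ennreal (min 1 (norm h) / norm (h::'a) powr \<alpha>) \<partial>lborel)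
      \<le> (\<integral>\<^sup>+ h. (\<Sum>k. f k h) + (\<Sum>k. g k h) \<partial>lborel)"
    by (intro nn_integral_mono pw)
  also have "\<dots> = (\<Sum>k. \<integral>\<^sup>+ h. f k h \<partial>lborel) + (\<Sum>k. \<integral>\<^sup>+ h. g k h \<partial>lborel)"
    by (subst nn_integral_add) (simp_all add: nn_integral_suminf)
  also have "\<dots> < \<infinity>"
  proof -
    have "2 powr (real n - \<alpha>) < 1" "2 powr (\<alpha> - real n - 1) < 1"
      using assms by (simp_all add: n_def powr_less_one)
    then have "(\<Sum>k. \<integral>\<^sup>+ h. f k h \<partial>lborel) < \<infinity>" "(\<Sum>k. \<integral>\<^sup>+ h. g k h \<partial>lborel) < \<infinity>"
      unfolding If Ig using \<omega> by (intro fin; simp)+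
    then show ?thesis by simp
  qed
  finally show ?thesis .
qed

section \<open>Sets whose translates vary in a Lipschitz way\<close>

definition translation_defect :: "('a::euclidean_space) set \<Rightarrow> 'a \<Rightarrow> ennreal" where
  "translation_defect A h = emeasure lborel {x. (x \<in> A) \<noteq> (x + h \<in> A)}"

text \<open>
  Equivalently, \<open>A\<close> is Borel, has finite perimeter, and \<open>A\<close> or its complement has finite measure. The
  formulation by translates is the form in which the energy estimate needs it, and it visibly
  passes to finite unions.
\<close>
definition lipschitz_translates :: "('a::euclidean_space) set \<Rightarrow> bool" where
  "lipschitz_translates A \<longleftrightarrow> A \<in> sets borel \<and>
     (\<exists>C\<ge>0. \<forall>h. translation_defect A h \<le> ennreal (C * min 1 (norm h)))"

lemma sets_translation_defect [measurable]:
  assumes [measurable]: "A \<in> sets borel"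
  shows "{x :: 'a::euclidean_space. (x \<in> A) \<noteq> (x + h \<in> A)} \<in> sets borel"
  by measurable

text \<open>If membership in a union changes under a translation, it changes for one of the two sets.\<close>
lemma lipschitz_translates_Un:
  assumes "lipschitz_translates A" "lipschitz_translates B"
  shows "lipschitz_translates (A \<union> B)"
proof -
  obtain C where C: "C \<ge> 0" "\<And>h. translation_defect A h \<le> ennreal (C * min 1 (norm h))"
    using assms(1) by (auto simp: lipschitz_translates_def)
  obtain D where D: "D \<ge> 0" "\<And>h. translation_defect B h \<le> ennreal (D * min 1 (norm h))"
    using assms(2) by (auto simp: lipschitz_translates_def)
  have [measurable]: "A \<in> sets borel" "B \<in> sets borel"
    using assms by (auto simp: lipschitz_translates_def)
  have "translation_defect (A \<union> B) h \<le> ennreal ((C + D) * min 1 (norm h))" for h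
  proof -
    have "translation_defect (A \<union> B) h \<le>
      emeasure lborel ({x. (x \<in> A) \<noteq> (x + h \<in> A)} \<union> {x. (x \<in> B) \<noteq> (x + h \<in> B)})"
      unfolding translation_defect_def by (intro emeasure_mono) auto
    also have "\<dots> \<le> translation_defect A h + translation_defect B h"
      unfolding translation_defect_def by (intro emeasure_subadditive) auto
    also have "\<dots> \<le> ennreal (C * min 1 (norm h)) + ennreal (D * min 1 (norm h))"
      by (intro add_mono C D)
    also have "\<dots> = ennreal ((C + D) * min 1 (norm h))"
      using C D by (simp add: ennreal_plus[symmetric] distrib_right del: ennreal_plus)
    finally show ?thesis .
  qed
  then show ?thesis
    unfolding lipschitz_translates_def using C D by (auto intro!: exI[of _ "C + D"])
qed

lemma lipschitz_translates_UN:
  assumes "finite I" "\<And>i. i \<in> I \<Longrightarrow> lipschitz_translates (A i)"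
  shows "lipschitz_translates (\<Union>i\<in>I. A i)"
  using assms
proof (induction I rule: finite_induct)
  case empty
  show ?case by (auto simp: lipschitz_translates_def translation_defect_def intro!: exI[of _ 0])
qed (auto intro: lipschitz_translates_Un)

lemma emeasure_cbox_cart:
  fixes l u :: "real ^ 'n"
  assumes "\<And>i. l $ i \<le> u $ i"
  shows "emeasure lborel (cbox l u) = ennreal (\<Prod>i\<in>UNIV. u $ i - l $ i)"
proof -
  have "cbox l u \<noteq> {}" using assms by (auto simp: interval_ne_empty_cart)
  then show ?thesis
    using emeasure_eq_ennreal_measure[of lborel "cbox l u"] emeasure_lborel_cbox_finite[of l u]
    by (simp add: content_cbox_cart)
qed

text \<open>The bound for the neighbourhood of a face: one side is short and the others are only bounded.\<close>
lemma emeasure_thin_cbox_le: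
  fixes l u :: "real ^ 'n"
  assumes "\<And>i. l $ i \<le> u $ i" "\<And>i. u $ i - l $ i \<le> M" "u $ j - l $ j \<le> t"
  shows "emeasure lborel (cbox l u) \<le> ennreal (t * M ^ (CARD('n) - 1))"
proof -
  have "(\<Prod>i\<in>UNIV. u $ i - l $ i) = (u $ j - l $ j) * (\<Prod>i\<in>UNIV - {j}. u $ i - l $ i)"
    by (rule prod.remove) auto
  also have "\<dots> \<le> t * (\<Prod>i\<in>UNIV - {j}. M)"
    using assms by (intro mult_mono prod_mono prod_nonneg) (auto intro: order_trans[of 0 "u $ j - l $ j"])
  also have "\<dots> = t * M ^ (CARD('n) - 1)" by (simp add: card_Diff_singleton)
  finally show ?thesis using emeasure_cbox_cart[OF assms(1)] by (simp add: ennreal_leI)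
qed

text \<open>
  A short translation changes membership in the box only for points within distance \<open>norm h\<close> of the
  hyperplane through one of the faces, hence only on finitely many boxes of thickness \<open>2 * norm h\<close>.
  For a long translation the box and its translate together are an adequate bound.
\<close>
lemma lipschitz_translates_cbox:
  fixes l u :: "real ^ 'n"
  shows "lipschitz_translates (cbox l u)"
proof (cases "cbox l u = {}")
  case True
  then show ?thesis using lipschitz_translates_UN[of "{}"] by simp
next
  case False
  then have lu: "l $ i \<le> u $ i" for i by (auto simp: interval_ne_empty_cart)
  define M where "M = Max (range (\<lambda>i. u $ i - l $ i)) + 2"
  have M: "u $ i - l $ i + 2 \<le> M" for i unfolding M_def by (simp add: Max_ge)
  have M2: "2 \<le> M" using M[of undefined] lu[of undefined] by linarith
  define V where "V = measure lborel (cbox l u)"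
  have V: "emeasure lborel (cbox l u) = ennreal V" "0 \<le> V"
    using emeasure_eq_ennreal_measure[of lborel "cbox l u"] emeasure_lborel_cbox_finite[of l u]
    by (auto simp: V_def)
  define C where "C = 2 * V + 4 * CARD('n) * M ^ (CARD('n) - 1)"
  have C0: "0 \<le> 4 * CARD('n) * M ^ (CARD('n) - 1)" using M2 by simp
  have "translation_defect (cbox l u) h \<le> ennreal (C * min 1 (norm h))" for h
  proof (cases "norm h \<le> 1")
    case False
    have "{x. (x \<in> cbox l u) \<noteq> (x + h \<in> cbox l u)} \<subseteq> cbox l u \<union> cbox (l - h) (u - h)"
      by (auto simp: mem_box_cart algebra_simps)
    then have "translation_defect (cbox l u) h \<le> emeasure lborel (cbox l u \<union> cbox (l - h) (u - h))"
      unfolding translation_defect_def by (intro emeasure_mono) auto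
    also have "\<dots> \<le> emeasure lborel (cbox l u) + emeasure lborel (cbox (l - h) (u - h))"
      by (intro emeasure_subadditive) auto
    also have "\<dots> = ennreal V + ennreal V"
      using emeasure_cbox_cart[of l u] emeasure_cbox_cart[of "l - h" "u - h"] lu V by simp
    also have "\<dots> \<le> ennreal (C * min 1 (norm h))"
      using False V C0 by (simp add: C_def ennreal_plus[symmetric] del: ennreal_plus)
    finally show ?thesis .
  next
    case True
    \<comment> \<open>Points at distance at most \<open>norm h\<close> from the hyperplane \<open>x $ i = c\<close>. The other sides are enlarged
      by \<open>1\<close> because \<open>x\<close> may lie outside the box when \<open>x + h\<close> lies inside.\<close>
    define E where "E i c = cbox (\<chi> j. if j = i then c - norm h else l $ j - 1)
      (\<chi> j. if j = i then c + norm h else u $ j + 1)" for i c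
    have hi: "\<bar>h $ i\<bar> \<le> norm h" for i by (rule component_le_norm_cart)
    have Em: "emeasure lborel (E i c) \<le> ennreal (2 * norm h * M ^ (CARD('n) - 1))" for i c
      unfolding E_def
    proof (rule emeasure_thin_cbox_le[where j = i])
      fix j
      show "(\<chi> j. if j = i then c + norm h else u $ j + 1) $ j - (\<chi> j. if j = i then c - norm h else l $ j - 1) $ j \<le> M"
        using M[of j] M2 True by auto
      show "(\<chi> j. if j = i then c - norm h else l $ j - 1) $ j \<le> (\<chi> j. if j = i then c + norm h else u $ j + 1) $ j"
        using lu[of j] norm_ge_zero[of h] by auto
    qed auto
    have sub: "{x. (x \<in> cbox l u) \<noteq> (x + h \<in> cbox l u)} \<subseteq> (\<Union>i. E i (l $ i) \<union> E i (u $ i))"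
    proof
      fix x assume "x \<in> {x. (x \<in> cbox l u) \<noteq> (x + h \<in> cbox l u)}"
      then have x: "(x \<in> cbox l u) \<noteq> (x + h \<in> cbox l u)" by simp
      then have near: "l $ j - 1 \<le> x $ j \<and> x $ j \<le> u $ j + 1" for j
        using hi[of j] True unfolding mem_box_cart vector_add_component by (smt (verit))
      from x obtain i where "\<bar>x $ i - l $ i\<bar> \<le> norm h \<or> \<bar>x $ i - u $ i\<bar> \<le> norm h"
        using hi unfolding mem_box_cart vector_add_component by (smt (verit))
      then have "x \<in> E i (l $ i) \<union> E i (u $ i)"
        using near by (auto simp: E_def mem_box_cart abs_le_iff algebra_simps)
      then show "x \<in> (\<Union>i. E i (l $ i) \<union> E i (u $ i))" by blast
    qed
    have [measurable]: "E i c \<in> sets borel" for i c unfolding E_def by simp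
    have "translation_defect (cbox l u) h \<le> emeasure lborel (\<Union>i. E i (l $ i) \<union> E i (u $ i))"
      unfolding translation_defect_def by (intro emeasure_mono sub) auto
    also have "\<dots> \<le> (\<Sum>i\<in>UNIV. emeasure lborel (E i (l $ i) \<union> E i (u $ i)))"
      by (intro emeasure_subadditive_finite) auto
    also have "\<dots> \<le> (\<Sum>i\<in>(UNIV::'n set). ennreal (2 * (2 * norm h * M ^ (CARD('n) - 1))))"
    proof (intro sum_mono)
      fix i
      have "emeasure lborel (E i (l $ i) \<union> E i (u $ i)) \<le> emeasure lborel (E i (l $ i)) + emeasure lborel (E i (u $ i))"
        by (intro emeasure_subadditive) auto
      also have "\<dots> \<le> ennreal (2 * norm h * M ^ (CARD('n) - 1)) + ennreal (2 * norm h * M ^ (CARD('n) - 1))"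
        by (intro add_mono Em)
      finally show "emeasure lborel (E i (l $ i) \<union> E i (u $ i)) \<le> ennreal (2 * (2 * norm h * M ^ (CARD('n) - 1)))"
        using M2 by (simp add: ennreal_plus[symmetric] del: ennreal_plus)
    qed
    also have "\<dots> = ennreal (CARD('n) * (2 * (2 * norm h * M ^ (CARD('n) - 1))))"
      using M2 by (subst sum_ennreal) auto
    also have "\<dots> \<le> ennreal (C * min 1 (norm h))"
      using True V by (intro ennreal_leI) (simp add: C_def algebra_simps)
    finally show ?thesis .
  qed
  then show ?thesis
    unfolding lipschitz_translates_def using V C0 by (intro conjI exI[of _ C]) (auto simp: C_def)
qed

section \<open>Reduction to iterated Borel integrals\<close>

lemma sigma_finite_lebesgue_on:
  fixes \<Omega> :: "('a::euclidean_space) set"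
  assumes "\<Omega> \<in> sets lebesgue"
  shows "sigma_finite_measure (lebesgue_on \<Omega>)"
proof -
  obtain A :: "'a set set" where A: "countable A" "A \<subseteq> sets lborel" "\<Union> A = space lborel"
      "\<forall>a\<in>A. emeasure lborel a \<noteq> \<infinity>"
    using lborel.sigma_finite_countable by auto
  have "sigma_finite_measure (lebesgue :: 'a measure)"
    by (rule sigma_finite_measure.intro, rule exI[of _ A]) (use A in auto)
  then show ?thesis using assms by (rule sigma_finite_measure_restrict_space)
qed

text \<open>
  For Borel integrands the completion built into \<open>lebesgue_on\<close> can be dropped, which
  makes translation and interchange of integrals with respect to \<open>lborel\<close> available.
\<close>
lemma nn_integral_lebesgue_on_pair:
  fixes F :: "'a::euclidean_space \<times> 'a \<Rightarrow> ennreal"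
  assumes F[measurable]: "F \<in> borel_measurable (borel \<Otimes>\<^sub>M borel)" and [measurable]: "\<Omega> \<in> sets borel"
  shows "integral\<^sup>N (lebesgue_on \<Omega> \<Otimes>\<^sub>M lebesgue_on \<Omega>) F =
    (\<integral>\<^sup>+ x. (\<integral>\<^sup>+ y. F (x, y) * indicator \<Omega> y \<partial>lborel) * indicator \<Omega> x \<partial>lborel)"
proof -
  interpret sigma_finite_measure "lebesgue_on \<Omega>"
    by (rule sigma_finite_lebesgue_on) simp
  have b: "(\<lambda>x. x) \<in> lebesgue_on \<Omega> \<rightarrow>\<^sub>M borel"
    by (intro measurable_restrict_space1 measurable_completion) simp
  have "(\<lambda>x. x) \<in> (lebesgue_on \<Omega> \<Otimes>\<^sub>M lebesgue_on \<Omega>) \<rightarrow>\<^sub>M (borel \<Otimes>\<^sub>M borel)"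
    using measurable_Pair[OF measurable_compose[OF measurable_fst b] measurable_compose[OF measurable_snd b]]
    by simp
  then have "F \<in> borel_measurable (lebesgue_on \<Omega> \<Otimes>\<^sub>M lebesgue_on \<Omega>)"
    using measurable_compose[OF _ F] by simp
  then show ?thesis
    by (simp add: nn_integral_fst[symmetric] nn_integral_restrict_space nn_integral_completion)
qed

lemma nn_integral_lborel_translate:
  fixes f :: "'a::euclidean_space \<Rightarrow> ennreal"
  assumes [measurable]: "f \<in> borel_measurable borel"
  shows "(\<integral>\<^sup>+ y. f y \<partial>lborel) = (\<integral>\<^sup>+ h. f (x + h) \<partial>lborel)"
  by (subst lborel_distr_plus[symmetric, of x]) (simp add: nn_integral_distr)


section \<open>The energy of two-valued functions\<close>

text \<open>
  Twice the fractional perimeter of \<open>A\<close>, restricted to pairs of points of \<open>\<Omega>\<close>, when \<open>\<alpha>\<close> is the dimension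
  plus an exponent between \<open>0\<close> and \<open>1\<close>.
\<close>
definition cross_energy :: "'a::euclidean_space set \<Rightarrow> real \<Rightarrow> 'a set \<Rightarrow> ennreal" where
  "cross_energy \<Omega> \<alpha> A =
    (\<integral>\<^sup>+ x. (\<integral>\<^sup>+ y. ennreal (of_bool ((x \<in> A) \<noteq> (y \<in> A)) / norm (y - x) powr \<alpha>) * indicator \<Omega> y \<partial>lborel)
       * indicator \<Omega> x \<partial>lborel)"

lemma frac_energy_two_valued:
  fixes \<Omega> :: "(real ^ 'n) set" and a b :: "real ^ 'm"
  assumes [measurable]: "\<Omega> \<in> sets borel" "A \<in> sets borel"
  shows "frac_energy \<Omega> s p (\<lambda>x. if x \<in> A then a else b)
    = ennreal (norm (b - a) powr p) * cross_energy \<Omega> (real CARD('n) + s * p) A"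
proof -
  define \<alpha> where "\<alpha> = real CARD('n) + s * p"
  define k where "k x y = ennreal (of_bool ((x \<in> A) \<noteq> (y \<in> A)) / norm (y - x) powr \<alpha>)" for x y :: "real ^ 'n"
  have pw: "ennreal (norm ((if y \<in> A then a else b) - (if x \<in> A then a else b)) powr p / norm (y - x) powr \<alpha>)
      = ennreal (norm (b - a) powr p) * k x y" for x y :: "real ^ 'n"
    by (auto simp: k_def ennreal_mult[symmetric] norm_minus_commute)
  have k[measurable]: "case_prod k \<in> borel_measurable (borel \<Otimes>\<^sub>M borel)"
    unfolding k_def of_bool_def split_beta' by measurable
  have k2[measurable]: "(\<lambda>z. ennreal (norm (b - a) powr p) * case_prod k z) \<in> borel_measurable (borel \<Otimes>\<^sub>M borel)"
    by measurable
  have "frac_energy \<Omega> s p (\<lambda>x. if x \<in> A then a else b)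
      = integral\<^sup>N (lebesgue_on \<Omega> \<Otimes>\<^sub>M lebesgue_on \<Omega>) (\<lambda>z. ennreal (norm (b - a) powr p) * case_prod k z)"
    unfolding frac_energy_def \<alpha>_def[symmetric] by (intro nn_integral_cong) (simp add: pw split_beta')
  also have "\<dots> = (\<integral>\<^sup>+ x. (\<integral>\<^sup>+ y. ennreal (norm (b - a) powr p) * k x y * indicator \<Omega> y \<partial>lborel) * indicator \<Omega> x \<partial>lborel)"
    by (subst nn_integral_lebesgue_on_pair[OF k2]) auto
  also have "\<dots> = ennreal (norm (b - a) powr p) * cross_energy \<Omega> \<alpha> A"
    unfolding cross_energy_def k_def[symmetric] mult.assoc
    by (simp add: nn_integral_cmult mult.assoc)
  finally show ?thesis unfolding \<alpha>_def .
qed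

text \<open>
  The substitution \<open>y = x + h\<close> and an interchange of the integrals turn the double integral over
  separated pairs into the integral of \<open>translation_defect A h / norm h powr \<alpha>\<close>.
\<close>
lemma cross_energy_finite:
  fixes A \<Omega> :: "'a::euclidean_space set"
  assumes A: "lipschitz_translates A" and \<alpha>: "real DIM('a) < \<alpha>" "\<alpha> < real DIM('a) + 1"
  shows "cross_energy \<Omega> \<alpha> A < \<infinity>"
proof -
  obtain C where C: "C \<ge> 0" "\<And>h. translation_defect A h \<le> ennreal (C * min 1 (norm h))"
    using A by (auto simp: lipschitz_translates_def)
  have [measurable]: "A \<in> sets borel"
    using A by (auto simp: lipschitz_translates_def)
  define J where "J x y = ennreal (of_bool ((x \<in> A) \<noteq> (y \<in> A)))" for x y :: 'a
  define w where "w h = ennreal (1 / norm h powr \<alpha>)" for h :: 'a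
  have J[measurable]: "case_prod J \<in> borel_measurable (borel \<Otimes>\<^sub>M borel)"
    unfolding J_def of_bool_def split_beta' by measurable
  have [measurable]: "w \<in> borel_measurable borel" unfolding w_def by measurable
  have split: "ennreal (of_bool ((x \<in> A) \<noteq> (y \<in> A)) / norm (y - x) powr \<alpha>) = J x y * w (y - x)" for x y
    by (auto simp: J_def w_def)
  have "cross_energy \<Omega> \<alpha> A \<le> (\<integral>\<^sup>+ x. \<integral>\<^sup>+ y. J x y * w (y - x) \<partial>lborel \<partial>lborel)"
    unfolding cross_energy_def split
    by (intro nn_integral_mono) (auto intro!: nn_integral_mono simp: indicator_def)
  also have "\<dots> = (\<integral>\<^sup>+ x. \<integral>\<^sup>+ h. J x (x + h) * w h \<partial>lborel \<partial>lborel)"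
  proof (rule nn_integral_cong)
    fix x
    show "(\<integral>\<^sup>+ y. J x y * w (y - x) \<partial>lborel) = (\<integral>\<^sup>+ h. J x (x + h) * w h \<partial>lborel)"
      using nn_integral_lborel_translate[of "\<lambda>y. J x y * w (y - x)" x] by simp
  qed
  also have "\<dots> = (\<integral>\<^sup>+ h. \<integral>\<^sup>+ x. J x (x + h) * w h \<partial>lborel \<partial>lborel)"
    by (rule lborel_pair.Fubini'[symmetric]) measurable
  also have "\<dots> = (\<integral>\<^sup>+ h. translation_defect A h * w h \<partial>lborel)"
  proof (intro nn_integral_cong)
    fix h
    have "(\<integral>\<^sup>+ x. J x (x + h) \<partial>lborel) = (\<integral>\<^sup>+ x. indicator {x. (x \<in> A) \<noteq> (x + h \<in> A)} x \<partial>lborel)"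
      by (intro nn_integral_cong) (auto simp: J_def indicator_def)
    also have "\<dots> = translation_defect A h"
      unfolding translation_defect_def by (rule nn_integral_indicator) simp
    finally show "(\<integral>\<^sup>+ x. J x (x + h) * w h \<partial>lborel) = translation_defect A h * w h"
      by (subst nn_integral_multc) auto
  qed
  also have "\<dots> \<le> (\<integral>\<^sup>+ h. ennreal C * ennreal (min 1 (norm (h::'a)) / norm h powr \<alpha>) \<partial>lborel)"
  proof (intro nn_integral_mono)
    fix h
    have "translation_defect A h * w h \<le> ennreal (C * min 1 (norm h)) * w h"
      by (intro mult_right_mono C) simp
    also have "\<dots> = ennreal C * ennreal (min 1 (norm h) / norm h powr \<alpha>)"
      using C by (simp add: w_def ennreal_mult[symmetric])
    finally show "translation_defect A h * w h \<le> ennreal C * ennreal (min 1 (norm h) / norm h powr \<alpha>)" .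
  qed
  also have "\<dots> = ennreal C * (\<integral>\<^sup>+ h. ennreal (min 1 (norm (h::'a)) / norm h powr \<alpha>) \<partial>lborel)"
    by (intro nn_integral_cmult) measurable
  also have "\<dots> < \<infinity>"
    using nn_integral_translation_kernel_finite[OF \<alpha>] by (simp add: ennreal_mult_less_top)
  finally show ?thesis .
qed

text \<open>
  The kernel is at least \<open>r powr (- \<alpha>)\<close> on all pairs \<open>(x, y)\<close> with \<open>x \<in> Q\<close> and \<open>y \<in> B x\<close>, and
  all these pairs are separated by \<open>A\<close>. Letting the partner set depend on \<open>x\<close> avoids
  computing the measure of either part of \<open>Q\<close>.
\<close>
lemma cross_energy_ge:
  fixes A Q \<Omega> :: "'a::euclidean_space set" and B :: "'a \<Rightarrow> 'a set"
  assumes Q: "Q \<in> sets borel" "Q \<subseteq> \<Omega>" and "0 < \<alpha>"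
    and B: "\<And>x. x \<in> Q \<Longrightarrow> B x \<in> sets borel" "\<And>x. x \<in> Q \<Longrightarrow> B x \<subseteq> \<Omega>"
      "\<And>x. x \<in> Q \<Longrightarrow> \<beta> \<le> emeasure lborel (B x)"
    and near: "\<And>x y. x \<in> Q \<Longrightarrow> y \<in> B x \<Longrightarrow> norm (y - x) \<le> r"
    and opp: "\<And>x y. x \<in> Q \<Longrightarrow> y \<in> B x \<Longrightarrow> (x \<in> A) \<noteq> (y \<in> A)"
  shows "ennreal (r powr (- \<alpha>)) * \<beta> * emeasure lborel Q \<le> cross_energy \<Omega> \<alpha> A"
proof -
  have inner: "ennreal (r powr (- \<alpha>)) * \<beta>
      \<le> (\<integral>\<^sup>+ y. ennreal (of_bool ((x \<in> A) \<noteq> (y \<in> A)) / norm (y - x) powr \<alpha>) * indicator \<Omega> y \<partial>lborel)"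
    if x: "x \<in> Q" for x
  proof -
    have "ennreal (r powr (- \<alpha>)) * \<beta> \<le> ennreal (r powr (- \<alpha>)) * emeasure lborel (B x)"
      by (intro mult_left_mono B x) simp
    also have "\<dots> = (\<integral>\<^sup>+ y. ennreal (r powr (- \<alpha>)) * indicator (B x) y \<partial>lborel)"
      using B(1)[OF x] by (simp add: nn_integral_cmult_indicator)
    also have "\<dots> \<le> (\<integral>\<^sup>+ y. ennreal (of_bool ((x \<in> A) \<noteq> (y \<in> A)) / norm (y - x) powr \<alpha>) * indicator \<Omega> y \<partial>lborel)"
    proof (intro nn_integral_mono)
      fix y
      show "ennreal (r powr (- \<alpha>)) * indicator (B x) y
          \<le> ennreal (of_bool ((x \<in> A) \<noteq> (y \<in> A)) / norm (y - x) powr \<alpha>) * indicator \<Omega> y"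
      proof (cases "y \<in> B x")
        case True
        then have "y \<noteq> x" "(x \<in> A) \<noteq> (y \<in> A)" "y \<in> \<Omega>" using opp[OF x True] B(2)[OF x] by auto
        moreover from this have "r powr (- \<alpha>) \<le> norm (y - x) powr (- \<alpha>)"
          using near[OF x True] \<open>0 < \<alpha>\<close> by (intro powr_mono2') auto
        ultimately show ?thesis using True by (simp add: powr_minus divide_inverse ennreal_leI)
      qed simp
    qed
    finally show ?thesis .
  qed
  have "ennreal (r powr (- \<alpha>)) * \<beta> * emeasure lborel Q = (\<integral>\<^sup>+ x. ennreal (r powr (- \<alpha>)) * \<beta> * indicator Q x \<partial>lborel)"
    using Q by (simp add: nn_integral_cmult_indicator)
  also have "\<dots> \<le> cross_energy \<Omega> \<alpha> A"
    unfolding cross_energy_def using inner Q(2)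
    by (intro nn_integral_mono) (auto simp: indicator_def)
  finally show ?thesis .
qed

section \<open>Stripes\<close>

text \<open>
  The interval \<open>{0..L}\<close> is cut into \<open>2 * N\<close> cells of width \<open>w\<close>, which belong to \<open>E\<close> alternately,
  beginning with the first. The cells are paired, and the required interval is the open partner cell: the one to
  the right of a cell in \<open>E\<close>, the one to the left of a cell outside \<open>E\<close>. Since the
  number of cells is even, the partner never leaves \<open>{0..L}\<close>.
\<close>
lemma stripes_opposite_interval:
  fixes w L t :: real and N :: nat
  defines "E \<equiv> \<Union>k<N. {2 * real k * w .. (2 * real k + 1) * w}"
  assumes "0 < w" and L: "L = 2 * real N * w" and t: "0 < t" "t < L"
  obtains c where "0 \<le> c" "c + w \<le> L"
    "\<And>r. c < r \<Longrightarrow> r < c + w \<Longrightarrow> \<bar>r - t\<bar> \<le> 2 * w \<and> (t \<in> E) \<noteq> (r \<in> E)"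
proof (cases "t \<in> E")
  case True
  then obtain k where k: "k < N" "2 * real k * w \<le> t" "t \<le> (2 * real k + 1) * w"
    by (auto simp: E_def)
  have "r \<notin> E" if r: "(2 * real k + 1) * w < r" "r < (2 * real k + 1) * w + w" for r
  proof
    assume "r \<in> E"
    then obtain m where m: "2 * real m * w \<le> r" "r \<le> (2 * real m + 1) * w" by (auto simp: E_def)
    have "2 * real m * w < (2 * real k + 2) * w" using m r by (simp add: algebra_simps)
    then have "m \<le> k" using \<open>0 < w\<close> by simp
    moreover have "(2 * real k + 1) * w < (2 * real m + 1) * w" using m r by linarith
    then have "k < m" using \<open>0 < w\<close> by simp
    ultimately show False by simp
  qed
  moreover have "(2 * real k + 1) * w + w \<le> L"
  proof -
    have "(2 * real k + 2) * w \<le> (2 * real N) * w" using k \<open>0 < w\<close> by (intro mult_right_mono) auto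
    then show ?thesis by (simp add: L algebra_simps)
  qed
  ultimately show thesis
    using that[of "(2 * real k + 1) * w"] k True \<open>0 < w\<close> by (simp add: algebra_simps abs_le_iff)
next
  case False
  define j where "j = nat \<lfloor>t / w\<rfloor>"
  have "0 \<le> \<lfloor>t / w\<rfloor>" using \<open>0 < w\<close> t by simp
  then have "real j \<le> t / w" "t / w < real j + 1" unfolding j_def by linarith+
  then have j: "real j * w \<le> t" "t < (real j + 1) * w" using \<open>0 < w\<close> by (simp_all add: field_simps)
  have "real j * w < (2 * real N) * w" using j t L by linarith
  then have "j < 2 * N" using \<open>0 < w\<close> by simp
  have "odd j"
  proof
    assume "even j"
    then obtain k where "j = 2 * k" by (rule evenE)
    then have "t \<in> E" using j \<open>j < 2 * N\<close> by (auto simp: E_def intro!: bexI[of _ k])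
    then show False using False by simp
  qed
  then obtain k where k: "j = 2 * k + 1" by (rule oddE)
  have "r \<in> E" if "2 * real k * w < r" "r < 2 * real k * w + w" for r
    using that \<open>j < 2 * N\<close> k by (auto simp: E_def algebra_simps intro!: bexI[of _ k])
  moreover have "2 * real k * w + w \<le> L"
    using j t k by (simp add: algebra_simps)
  ultimately show thesis
    using that[of "2 * real k * w"] j k False \<open>0 < w\<close> by (simp add: algebra_simps abs_le_iff)
qed

lemma open_contains_cube:
  fixes \<Omega> :: "(real ^ 'n) set"
  assumes "open \<Omega>" "\<Omega> \<noteq> {}"
  obtains q L where "0 < L" "cbox q (\<chi> i. q $ i + L) \<subseteq> \<Omega>"
proof -
  obtain q where "q \<in> \<Omega>" using assms by auto
  then obtain e where e: "0 < e" "cball q e \<subseteq> \<Omega>" using assms by (auto simp: open_contains_cball)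
  define L where "L = e / CARD('n)"
  have "y \<in> cball q e" if "y \<in> cbox q (\<chi> i. q $ i + L)" for y
  proof -
    have "norm (y - q) \<le> (\<Sum>i\<in>UNIV. \<bar>(y - q) $ i\<bar>)" by (rule norm_le_l1_cart)
    also have "\<dots> \<le> (\<Sum>i\<in>(UNIV::'n set). L)"
      using that by (intro sum_mono) (auto simp: mem_box_cart abs_le_iff algebra_simps)
    also have "\<dots> = e" by (simp add: L_def)
    finally show ?thesis by (simp add: dist_norm norm_minus_commute)
  qed
  then have "cbox q (\<chi> i. q $ i + L) \<subseteq> \<Omega>" using e by blast
  then show thesis using that[of L q] e by (simp add: L_def)
qed

text \<open>
  The cube is striped in one coordinate direction. The partner of a point \<open>x\<close> is an open cube of side
  \<open>w\<close>: in the striped direction it spans the partner cell of \<open>x $ i0\<close>, in every other direction it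
  extends from \<open>x\<close> to whichever side stays inside the large cube. Its points differ from \<open>x\<close> by at
  most \<open>2 * w\<close> in each coordinate, whence the distance bound \<open>2 * CARD('n) * w\<close>.
\<close>
lemma striped_set_large_cross_energy:
  fixes \<Omega> :: "(real ^ 'n) set" and L \<alpha> w :: real and N :: nat
  assumes cube: "cbox q (\<chi> i. q $ i + L) \<subseteq> \<Omega>" and "0 < \<alpha>" "0 < w" "0 < N" and L: "L = 2 * real N * w"
  obtains A where "lipschitz_translates A"
    "ennreal ((2 * CARD('n) * w) powr (- \<alpha>) * w ^ CARD('n) * L ^ CARD('n)) \<le> cross_energy \<Omega> \<alpha> A"
proof -
  obtain i0 :: 'n where True by simp
  define E where "E = (\<Union>k<N. {2 * real k * w .. (2 * real k + 1) * w})"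
  define S where "S k = cbox (\<chi> i. if i = i0 then q $ i + 2 * real k * w else q $ i)
    (\<chi> i. if i = i0 then q $ i + (2 * real k + 1) * w else q $ i + L)" for k
  define A where "A = (\<Union>k<N. S k)"
  define Q where "Q = box q (\<chi> i. q $ i + L)"
  have "2 * w \<le> L" using \<open>0 < w\<close> \<open>0 < N\<close> by (simp add: L)
  have A_iff: "y \<in> A \<longleftrightarrow> y $ i0 - q $ i0 \<in> E" if "y \<in> Q" for y
  proof -
    have "y \<in> S k \<longleftrightarrow> y $ i0 - q $ i0 \<in> {2 * real k * w .. (2 * real k + 1) * w}" for k
      using that unfolding S_def Q_def mem_box_cart atLeastAtMost_iff vec_lambda_beta by (smt (verit))
    then show ?thesis by (simp add: A_def E_def)
  qed
  have "\<exists>c. \<forall>x\<in>Q. box (c x) (\<chi> i. c x $ i + w) \<subseteq> Q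
      \<and> (\<forall>y\<in>box (c x) (\<chi> i. c x $ i + w). norm (y - x) \<le> 2 * CARD('n) * w \<and> (x \<in> A) \<noteq> (y \<in> A))"
  proof (intro bchoice ballI)
    fix x assume x: "x \<in> Q"
    then have xi: "q $ i < x $ i" "x $ i < q $ i + L" for i by (auto simp: Q_def mem_box_cart)
    then have "0 < x $ i0 - q $ i0" "x $ i0 - q $ i0 < L" by (simp_all add: algebra_simps)
    from stripes_opposite_interval[OF \<open>0 < w\<close> L this, folded E_def]
    obtain d where d: "0 \<le> d" "d + w \<le> L"
      "\<And>r. d < r \<Longrightarrow> r < d + w \<Longrightarrow> \<bar>r - (x $ i0 - q $ i0)\<bar> \<le> 2 * w \<and> (x $ i0 - q $ i0 \<in> E) \<noteq> (r \<in> E)"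
      by metis
    define c where "c = (\<chi> i. if i = i0 then q $ i + d else if x $ i + w \<le> q $ i + L then x $ i else x $ i - w)"
    have c: "q $ i \<le> c $ i" "c $ i + w \<le> q $ i + L" for i
      using d xi[of i] \<open>2 * w \<le> L\<close> \<open>0 < w\<close> by (auto simp: c_def)
    have sub: "box c (\<chi> i. c $ i + w) \<subseteq> Q"
      unfolding Q_def
    proof (rule subsetI)
      fix y assume "y \<in> box c (\<chi> i. c $ i + w)"
      then show "y \<in> box q (\<chi> i. q $ i + L)"
        using c unfolding mem_box_cart vec_lambda_beta by (meson le_less_trans less_le_trans)
    qed
    moreover have "norm (y - x) \<le> 2 * CARD('n) * w \<and> (x \<in> A) \<noteq> (y \<in> A)"
      if y: "y \<in> box c (\<chi> i. c $ i + w)" for y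
    proof -
      have yi: "c $ i < y $ i" "y $ i < c $ i + w" for i using y by (auto simp: mem_box_cart)
      have y0: "d < y $ i0 - q $ i0" "y $ i0 - q $ i0 < d + w" using yi[of i0] by (auto simp: c_def)
      have "\<bar>y $ i - x $ i\<bar> \<le> 2 * w" for i
        using d(3)[OF y0] yi[of i] \<open>0 < w\<close> by (cases "i = i0") (auto simp: c_def split: if_splits)
      then have "(\<Sum>i\<in>UNIV. \<bar>(y - x) $ i\<bar>) \<le> (\<Sum>i\<in>(UNIV::'n set). 2 * w)"
        by (intro sum_mono) simp
      with norm_le_l1_cart[of "y - x"] have "norm (y - x) \<le> 2 * CARD('n) * w" by simp
      then show ?thesis using d(3)[OF y0] A_iff[OF x] A_iff[of y] sub y by auto
    qed
    ultimately show "\<exists>c. box c (\<chi> i. c $ i + w) \<subseteq> Q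
      \<and> (\<forall>y\<in>box c (\<chi> i. c $ i + w). norm (y - x) \<le> 2 * CARD('n) * w \<and> (x \<in> A) \<noteq> (y \<in> A))"
      by blast
  qed
  then obtain c where c: "\<And>x. x \<in> Q \<Longrightarrow> box (c x) (\<chi> i. c x $ i + w) \<subseteq> Q"
    "\<And>x y. x \<in> Q \<Longrightarrow> y \<in> box (c x) (\<chi> i. c x $ i + w) \<Longrightarrow> norm (y - x) \<le> 2 * CARD('n) * w"
    "\<And>x y. x \<in> Q \<Longrightarrow> y \<in> box (c x) (\<chi> i. c x $ i + w) \<Longrightarrow> (x \<in> A) \<noteq> (y \<in> A)"
    by blast
  have vol: "emeasure lborel (box a (\<chi> i. a $ i + t)) = ennreal (t ^ CARD('n))" if "0 \<le> t" for a :: "real ^ 'n" and t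
    using emeasure_cbox_cart[of a "\<chi> i. a $ i + t"] that
    by (simp add: emeasure_lborel_box_eq emeasure_lborel_cbox_eq)
  have Q\<Omega>: "Q \<subseteq> \<Omega>" using cube box_subset_cbox unfolding Q_def by blast
  have "ennreal ((2 * CARD('n) * w) powr (- \<alpha>)) * ennreal (w ^ CARD('n)) * emeasure lborel Q \<le> cross_energy \<Omega> \<alpha> A"
  proof (rule cross_energy_ge[where B = "\<lambda>x. box (c x) (\<chi> i. c x $ i + w)"])
    fix x assume "x \<in> Q"
    then show "box (c x) (\<chi> i. c x $ i + w) \<subseteq> \<Omega>" using c(1) Q\<Omega> by blast
    show "ennreal (w ^ CARD('n)) \<le> emeasure lborel (box (c x) (\<chi> i. c x $ i + w))"
      using vol[of w "c x"] \<open>0 < w\<close> by simp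
  qed (use c Q\<Omega> \<open>0 < \<alpha>\<close> in \<open>auto simp: Q_def\<close>)
  moreover have "emeasure lborel Q = ennreal (L ^ CARD('n))"
    using vol[of L q] \<open>2 * w \<le> L\<close> \<open>0 < w\<close> by (simp add: Q_def)
  moreover have "lipschitz_translates A"
    unfolding A_def S_def by (intro lipschitz_translates_UN lipschitz_translates_cbox) simp
  ultimately show thesis
    using that[of A] \<open>2 * w \<le> L\<close> \<open>0 < w\<close> by (simp add: ennreal_mult[symmetric])
qed

text \<open>
  With \<open>\<alpha> = CARD('n) + \<sigma>\<close> the lower bound for stripes of width \<open>w\<close> is a constant times
  \<open>w powr (- \<sigma>)\<close>, and the number of stripes can be increased at will in a fixed cube.
\<close>
lemma lipschitz_translates_cross_energy_at_top:
  fixes \<Omega> :: "(real ^ 'n) set"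
  assumes "open \<Omega>" "\<Omega> \<noteq> {}" and \<sigma>: "0 < \<sigma>"
  obtains A where "\<And>j. lipschitz_translates (A j)"
    "(\<lambda>j::nat. cross_energy \<Omega> (real CARD('n) + \<sigma>) (A j)) \<longlonglongrightarrow> \<infinity>"
proof -
  obtain q L where L: "0 < L" and cube: "cbox q (\<chi> i. q $ i + L) \<subseteq> \<Omega>"
    using open_contains_cube[OF assms(1,2)] .
  define \<alpha> where "\<alpha> = real CARD('n) + \<sigma>"
  define w where "w j = L / (2 * real (Suc j))" for j
  have w: "0 < w j" "L = 2 * real (Suc j) * w j" for j
    using L unfolding w_def by (auto simp: field_simps)
  define K where "K = (2 * CARD('n)) powr (- \<alpha>) * L ^ CARD('n)"
  have K: "0 < K" using L by (simp add: K_def)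
  have "0 < \<alpha>" using \<sigma> by (simp add: \<alpha>_def add_nonneg_pos)
  have eq: "(2 * CARD('n) * w j) powr (- \<alpha>) * w j ^ CARD('n) * L ^ CARD('n) = K * w j powr (- \<sigma>)" for j
  proof -
    have cancel: "w j powr (- \<alpha>) * w j ^ CARD('n) = w j powr (- \<sigma>)"
      using w(1)[of j] by (simp add: powr_realpow[symmetric] powr_add[symmetric] \<alpha>_def)
    have "(2 * CARD('n) * w j) powr (- \<alpha>) = (2 * CARD('n)) powr (- \<alpha>) * w j powr (- \<alpha>)"
      by (rule powr_mult)
    then show ?thesis unfolding K_def cancel[symmetric] by (simp only: mult_ac)
  qed
  have "\<exists>A. lipschitz_translates A \<and> ennreal (K * w j powr (- \<sigma>)) \<le> cross_energy \<Omega> \<alpha> A" for j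
    using striped_set_large_cross_energy[OF cube \<open>0 < \<alpha>\<close> w(1)[of j] zero_less_Suc w(2)[of j]] unfolding eq by metis
  then obtain A where A: "\<And>j. lipschitz_translates (A j)"
      "\<And>j. ennreal (K * w j powr (- \<sigma>)) \<le> cross_energy \<Omega> \<alpha> (A j)" by metis
  have "LIM j sequentially. K * w j powr (- \<sigma>) :> at_top"
  proof (rule filterlim_tendsto_pos_mult_at_top[OF tendsto_const K])
    have "w = (\<lambda>j. L / 2 * inverse (real (Suc j)))"
      unfolding w_def by (rule ext) (simp only: divide_inverse inverse_mult_distrib mult.assoc)
    then have "w \<longlonglongrightarrow> 0"
      using tendsto_mult_right_zero[OF LIMSEQ_inverse_real_of_nat, of "L / 2"] by (simp only:)
    moreover have "0 \<le> w j" for j using w(1)[of j] by simp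
    ultimately have "(\<lambda>j. w j powr \<sigma>) \<longlonglongrightarrow> 0"
      using \<sigma> by (intro tendsto_zero_powrI[where b = \<sigma>]) auto
    moreover have "0 < w j powr \<sigma>" for j using w(1)[of j] by simp
    ultimately show "LIM j sequentially. w j powr (- \<sigma>) :> at_top"
      unfolding powr_minus by (intro filterlim_inverse_at_top always_eventually allI)
  qed
  then have "(\<lambda>j. ennreal (K * w j powr (- \<sigma>))) \<longlonglongrightarrow> \<infinity>"
    by (simp add: ennreal_tendsto_top_eq_at_top)
  then have "(\<lambda>j. cross_energy \<Omega> \<alpha> (A j)) \<longlonglongrightarrow> \<infinity>"
    by (rule tendsto_sandwich[OF _ _ _ tendsto_const, rotated 2]) (auto simp: A)
  then show thesis using that A(1) unfolding \<alpha>_def by blast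
qed

section \<open>Non-injective functions do not control the energy\<close>

theorem proposition4p1:
  fixes \<Omega> :: "(real ^ 'n) set" and f :: "real ^ 'm \<Rightarrow> real ^ 'l" and s p :: real
  assumes "open \<Omega>" and "\<Omega> \<noteq> {}"
    and "0 < s" and "s < 1" and "1 \<le> p"
    and "s * p < 1"
    and "\<not> inj f"
  shows "\<exists>u :: nat \<Rightarrow> real ^ 'n \<Rightarrow> real ^ 'm.
    (\<forall>j. u j \<in> hom_frac_sobolev \<Omega> s p) \<and>
    (\<forall>j. (f \<circ> u j) constant_on \<Omega>) \<and>
    (\<lambda>j. frac_energy \<Omega> s p (u j)) \<longlonglongrightarrow> \<infinity>"
proof -
  obtain a b where ab: "f a = f b" "a \<noteq> b" using \<open>\<not> inj f\<close> by (auto simp: inj_on_def)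
  have sp: "0 < s * p" using assms by simp
  obtain A where A: "\<And>j. lipschitz_translates (A j)"
    "(\<lambda>j::nat. cross_energy \<Omega> (real CARD('n) + s * p) (A j)) \<longlonglongrightarrow> \<infinity>"
    using lipschitz_translates_cross_energy_at_top[OF assms(1,2) sp] by metis
  have A_borel [measurable]: "A j \<in> sets borel" for j
    using A(1)[of j] by (simp add: lipschitz_translates_def)
  define u where "u j x = (if x \<in> A j then a else b)" for j x
  have energy: "frac_energy \<Omega> s p (u j) =
      ennreal (norm (b - a) powr p) * cross_energy \<Omega> (real CARD('n) + s * p) (A j)" for j
    unfolding u_def using \<open>open \<Omega>\<close> by (intro frac_energy_two_valued A_borel) simp
  have "u j \<in> hom_frac_sobolev \<Omega> s p" for j
  proof -
    have "u j \<in> borel_measurable borel" unfolding u_def by measurable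
    then have "u j \<in> borel_measurable (lebesgue_on \<Omega>)"
      by (intro measurable_restrict_space1 measurable_completion) simp
    moreover have "cross_energy \<Omega> (real CARD('n) + s * p) (A j) < \<infinity>"
      using sp \<open>s * p < 1\<close> by (intro cross_energy_finite A) auto
    ultimately show ?thesis
      by (simp add: hom_frac_sobolev_def energy ennreal_mult_less_top)
  qed
  moreover have "(f \<circ> u j) constant_on \<Omega>" for j
    using ab by (auto simp: constant_on_def u_def)
  moreover have "(\<lambda>j. frac_energy \<Omega> s p (u j)) \<longlonglongrightarrow> \<infinity>"
  proof -
    have "(\<lambda>j. ennreal (norm (b - a) powr p) * cross_energy \<Omega> (real CARD('n) + s * p) (A j))
        \<longlonglongrightarrow> ennreal (norm (b - a) powr p) * \<infinity>"
      using ab by (intro tendsto_mult_ennreal tendsto_const A) auto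
    then show ?thesis using ab by (simp add: energy ennreal_mult_top)
  qed
  ultimately show ?thesis by blast
qed

end
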